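(* For every integer $n\geq 5$ we have $\operatorname{covdim} A_n\leq\operatorname{covdim} S_n\leq n-2$, where $S_n$ and $A_n$ denote the symmetric and alternating groups on $n$ letters.
   Context: The base field is $\mathbb C$; all $G$-modules are finite-dimensional over $\mathbb C$. A covariant of a finite group $G$ is a $G$-equivariant morphism (polynomial map) $\varphi\colon V\to W$ between $G$-modules; its dimension is $\dim\varphi:=\dim\overline{\varphi(V)}$. It is faithful if $G$ acts faithfully on the image $\varphi(V)$. The covariant dimension $\operatorname{covdim} G$ is the minimum of $\dim\varphi$ over all faithful covariants $\varphi$ of $G$. *)

theory Defs
  imports
    "HOL-Algebra.Sym_Groups"
    "HOL-Analysis.Abstract_Topology"
    "HOL-Library.Extended_Nat"
    "Jordan_Normal_Form.Matrix"
begin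

subsection \<open>Polynomial functions and the Zariski topology on affine space\<close>

text \<open>Affine \<open>m\<close>-space is \<open>carrier_vec m\<close>, so only the values on that set matter.
  As the base field is infinite, regular functions are the same as polynomial functions.\<close>

inductive_set poly_fun :: "nat \<Rightarrow> (complex vec \<Rightarrow> complex) set" for m :: nat where
  const: "(\<lambda>_. c) \<in> poly_fun m"
| coord: "i < m \<Longrightarrow> (\<lambda>x. x $ i) \<in> poly_fun m"
| add: "p \<in> poly_fun m \<Longrightarrow> q \<in> poly_fun m \<Longrightarrow> (\<lambda>x. p x + q x) \<in> poly_fun m"
| mult: "p \<in> poly_fun m \<Longrightarrow> q \<in> poly_fun m \<Longrightarrow> (\<lambda>x. p x * q x) \<in> poly_fun m"

definition zero_set :: "nat \<Rightarrow> (complex vec \<Rightarrow> complex) set \<Rightarrow> complex vec set" where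
  "zero_set m S = {x \<in> carrier_vec m. \<forall>p\<in>S. p x = 0}"

definition zariski :: "nat \<Rightarrow> complex vec topology" where
  "zariski m = topology (\<lambda>U. \<exists>S\<subseteq>poly_fun m. U = carrier_vec m - zero_set m S)"

lemma istopology_zariski:
  "istopology (\<lambda>U. \<exists>S\<subseteq>poly_fun m. U = carrier_vec m - zero_set m S)"
  unfolding istopology_def
proof (intro conjI allI impI)
  fix U V
  assume "\<exists>S\<subseteq>poly_fun m. U = carrier_vec m - zero_set m S"
    and "\<exists>S\<subseteq>poly_fun m. V = carrier_vec m - zero_set m S"
  then obtain S T where S: "S \<subseteq> poly_fun m" "U = carrier_vec m - zero_set m S"
    and T: "T \<subseteq> poly_fun m" "V = carrier_vec m - zero_set m T" by blast
  let ?R = "{\<lambda>x. p x * q x | p q. p \<in> S \<and> q \<in> T}"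
  have "?R \<subseteq> poly_fun m" using S(1) T(1) by (auto intro: poly_fun.mult)
  moreover have "U \<inter> V = carrier_vec m - zero_set m ?R"
    unfolding S(2) T(2) zero_set_def by auto (metis mult_eq_0_iff)+
  ultimately show "\<exists>S\<subseteq>poly_fun m. U \<inter> V = carrier_vec m - zero_set m S" by blast
next
  fix K
  assume "\<forall>U\<in>K. \<exists>S\<subseteq>poly_fun m. U = carrier_vec m - zero_set m S"
  then obtain f where f: "\<And>U. U \<in> K \<Longrightarrow> f U \<subseteq> poly_fun m"
    "\<And>U. U \<in> K \<Longrightarrow> U = carrier_vec m - zero_set m (f U)" by metis
  have "\<Union>K = (\<Union>U\<in>K. carrier_vec m - zero_set m (f U))" using f(2) by auto
  also have "\<dots> = carrier_vec m - zero_set m (\<Union>U\<in>K. f U)"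
    unfolding zero_set_def by auto
  finally show "\<exists>S\<subseteq>poly_fun m. \<Union>K = carrier_vec m - zero_set m S"
    using f(1) by (intro exI[of _ "\<Union>U\<in>K. f U"]) auto
qed

lemma topspace_zariski: "topspace (zariski m) = carrier_vec m"
proof -
  have "carrier_vec m = carrier_vec m - zero_set m {\<lambda>_. 1}" by (auto simp: zero_set_def)
  then have "openin (zariski m) (carrier_vec m)"
    unfolding zariski_def topology_inverse'[OF istopology_zariski]
    by (intro exI[of _ "{\<lambda>_. 1}"]) (auto intro: poly_fun.const)
  moreover have "U \<subseteq> carrier_vec m" if "openin (zariski m) U" for U
    using that unfolding zariski_def topology_inverse'[OF istopology_zariski] by auto
  ultimately show ?thesis unfolding topspace_def by blast
qed

lemma closedin_zariski:
  "closedin (zariski m) Z \<longleftrightarrow> (\<exists>S\<subseteq>poly_fun m. Z = zero_set m S)"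
proof -
  have 1: "Z = zero_set m S \<longleftrightarrow> Z \<subseteq> carrier_vec m \<and> carrier_vec m - Z = carrier_vec m - zero_set m S"
    for S by (auto simp: zero_set_def)
  show ?thesis
    unfolding closedin_def topspace_zariski unfolding 1
    unfolding zariski_def topology_inverse'[OF istopology_zariski] by blast
qed


subsection \<open>Krull dimension\<close>

definition irreducible_in :: "'a topology \<Rightarrow> 'a set \<Rightarrow> bool" where
  "irreducible_in X S \<longleftrightarrow> S \<subseteq> topspace X \<and> S \<noteq> {} \<and>
     (\<forall>A B. closedin X A \<and> closedin X B \<and> S \<subseteq> A \<union> B \<longrightarrow> S \<subseteq> A \<or> S \<subseteq> B)"

text \<open>The empty space gets dimension \<open>0\<close> here; images of covariants are never empty.\<close>

definition krull_dim :: "'a topology \<Rightarrow> enat" where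
  "krull_dim X = Sup {enat r | r. \<exists>C :: nat \<Rightarrow> 'a set.
     (\<forall>i\<le>r. closedin X (C i) \<and> irreducible_in X (C i)) \<and> (\<forall>i<r. C i \<subset> C (Suc i))}"


subsection \<open>Covariants\<close>

definition GL :: "nat \<Rightarrow> complex mat monoid" where
  "GL m = units_of (ring_mat TYPE(complex) m ())"

text \<open>After a choice of basis, a finite-dimensional \<open>G\<close>-module is \<open>carrier_vec m\<close> with a matrix
  representation \<open>\<rho>\<close> of \<open>G\<close>.\<close>

definition is_module :: "('g, 'b) monoid_scheme \<Rightarrow> nat \<Rightarrow> ('g \<Rightarrow> complex mat) \<Rightarrow> bool" where
  "is_module G m \<rho> \<longleftrightarrow> \<rho> \<in> hom G (GL m)"

definition poly_map :: "nat \<Rightarrow> nat \<Rightarrow> (complex vec \<Rightarrow> complex vec) \<Rightarrow> bool" where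
  "poly_map m k \<phi> \<longleftrightarrow> \<phi> \<in> carrier_vec m \<rightarrow> carrier_vec k \<and>
     (\<forall>j<k. \<exists>p\<in>poly_fun m. \<forall>x\<in>carrier_vec m. \<phi> x $ j = p x)"

definition is_covariant :: "('g, 'b) monoid_scheme \<Rightarrow> nat \<Rightarrow> ('g \<Rightarrow> complex mat) \<Rightarrow>
    nat \<Rightarrow> ('g \<Rightarrow> complex mat) \<Rightarrow> (complex vec \<Rightarrow> complex vec) \<Rightarrow> bool" where
  "is_covariant G m \<rho> k \<sigma> \<phi> \<longleftrightarrow> is_module G m \<rho> \<and> is_module G k \<sigma> \<and> poly_map m k \<phi> \<and>
     (\<forall>g\<in>carrier G. \<forall>v\<in>carrier_vec m. \<phi> (\<rho> g *\<^sub>v v) = \<sigma> g *\<^sub>v \<phi> v)"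

definition covariant_dim :: "nat \<Rightarrow> nat \<Rightarrow> (complex vec \<Rightarrow> complex vec) \<Rightarrow> enat" where
  "covariant_dim m k \<phi> =
     krull_dim (subtopology (zariski k) (zariski k closure_of (\<phi> ` carrier_vec m)))"

definition is_faithful_covariant :: "('g, 'b) monoid_scheme \<Rightarrow> nat \<Rightarrow> ('g \<Rightarrow> complex mat) \<Rightarrow>
    nat \<Rightarrow> ('g \<Rightarrow> complex mat) \<Rightarrow> (complex vec \<Rightarrow> complex vec) \<Rightarrow> bool" where
  "is_faithful_covariant G m \<rho> k \<sigma> \<phi> \<longleftrightarrow> is_covariant G m \<rho> k \<sigma> \<phi> \<and>
     (\<forall>g\<in>carrier G. (\<forall>w\<in>\<phi> ` carrier_vec m. \<sigma> g *\<^sub>v w = w) \<longrightarrow> g = \<one>\<^bsub>G\<^esub>)"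

text \<open>As \<open>enat\<close> is well-ordered, the infimum is attained whenever a faithful covariant exists;
  it is \<open>\<infinity>\<close> otherwise.\<close>

definition covdim :: "('g, 'b) monoid_scheme \<Rightarrow> enat" where
  "covdim G = Inf {covariant_dim m k \<phi> | m k \<rho> \<sigma> \<phi>. is_faithful_covariant G m \<rho> k \<sigma> \<phi>}"

end

theory Submission
  imports Defs
begin

text \<open>For \<open>a \<noteq> b\<close> consider the product \<open>P a b\<close> of \<open>(x a - x b) ^ (2 * (n - 3))\<close> with all
  \<open>x i - x j\<close> for distinct \<open>i, j\<close> not in \<open>{a, b}\<close>. Every index occurs in it equally often, so a
  Moebius transformation of the \<open>x i\<close> multiplies all \<open>P a b\<close> by one common factor. Hence the
  covariant of the symmetric group whose coordinates are the \<open>P a b\<close>, each multiplied with the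
  discriminant, has its values in the image of a polynomial map on affine \<open>(n - 2)\<close>-space: send
  three of the points to \<open>\<infinity>, 0, 1\<close>, and use the remaining \<open>n - 3\<close> points and the common factor as
  coordinates. If two points coincide, the discriminant makes the value zero. For \<open>n \<ge> 5\<close> the
  zeros of \<open>P a b\<close> determine \<open>{a, b}\<close>, so the covariant is faithful.

  The image of a polynomial map on affine \<open>d\<close>-space has dimension at most \<open>d\<close>: a chain of \<open>r + 1\<close>
  irreducible closed subsets gives \<open>r\<close> algebraically independent functions, each vanishing on one
  member of the chain and not on the next, and for \<open>r > d\<close> these would have more monomials than
  there is room for among the polynomials of bounded degree in \<open>d\<close> variables.\<close>

subsection \<open>Polynomial functions\<close>

lemma poly_fun_sum:
  assumes "\<And>i. i \<in> A \<Longrightarrow> f i \<in> poly_fun m"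
  shows "(\<lambda>x. \<Sum>i\<in>A. f i x) \<in> poly_fun m"
  using assms by (induction A rule: infinite_finite_induct) (auto intro: poly_fun.intros)

lemma poly_fun_prod:
  assumes "\<And>i. i \<in> A \<Longrightarrow> f i \<in> poly_fun m"
  shows "(\<lambda>x. \<Prod>i\<in>A. f i x) \<in> poly_fun m"
  using assms by (induction A rule: infinite_finite_induct) (auto intro: poly_fun.intros)

lemma poly_fun_power:
  assumes "f \<in> poly_fun m"
  shows "(\<lambda>x. f x ^ k) \<in> poly_fun m"
  using assms by (induction k) (auto intro: poly_fun.intros)

lemma poly_fun_diff:
  assumes "f \<in> poly_fun m" "g \<in> poly_fun m"
  shows "(\<lambda>x. f x - g x) \<in> poly_fun m"
proof -
  have "(\<lambda>x. f x + (\<lambda>_. -1) x * g x) \<in> poly_fun m"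
    using assms by (intro poly_fun.add poly_fun.mult poly_fun.const)
  then show ?thesis by simp
qed

lemma poly_fun_compose:
  assumes "p \<in> poly_fun k" "poly_map m k \<psi>"
  shows "\<exists>q\<in>poly_fun m. \<forall>x\<in>carrier_vec m. p (\<psi> x) = q x"
  using assms(1)
proof induction
  case (const c)
  then show ?case by (intro bexI[of _ "\<lambda>_. c"]) (auto intro: poly_fun.const)
next
  case (coord i)
  then show ?case using assms(2) unfolding poly_map_def by auto
next
  case (add p q)
  then obtain p' q' where "p' \<in> poly_fun m" "q' \<in> poly_fun m"
    "\<forall>x\<in>carrier_vec m. p (\<psi> x) = p' x" "\<forall>x\<in>carrier_vec m. q (\<psi> x) = q' x" by blast
  then show ?case by (intro bexI[of _ "\<lambda>x. p' x + q' x"]) (auto intro: poly_fun.add)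
next
  case (mult p q)
  then obtain p' q' where "p' \<in> poly_fun m" "q' \<in> poly_fun m"
    "\<forall>x\<in>carrier_vec m. p (\<psi> x) = p' x" "\<forall>x\<in>carrier_vec m. q (\<psi> x) = q' x" by blast
  then show ?case by (intro bexI[of _ "\<lambda>x. p' x * q' x"]) (auto intro: poly_fun.mult)
qed

subsection \<open>Polynomials of bounded partial degrees\<close>

text \<open>Bounding each partial degree separately gives the span of a box of
  \<open>Suc D ^ m\<close> monomials, which is easy to count.\<close>

definition bounded_poly :: "nat \<Rightarrow> nat \<Rightarrow> (complex vec \<Rightarrow> complex) set" where
  "bounded_poly m D = {f. \<exists>c. \<forall>x\<in>carrier_vec m.
     f x = (\<Sum>a\<in>{..<m} \<rightarrow>\<^sub>E {..D}. c a * (\<Prod>i<m. x $ i ^ a i))}"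

lemma bounded_polyI:
  assumes "finite S" "\<And>s. s \<in> S \<Longrightarrow> g s \<in> {..<m} \<rightarrow>\<^sub>E {..D}"
    and f: "\<And>x. x \<in> carrier_vec m \<Longrightarrow> f x = (\<Sum>s\<in>S. k s * (\<Prod>i<m. x $ i ^ g s i))"
  shows "f \<in> bounded_poly m D"
proof -
  have "f x = (\<Sum>a\<in>{..<m} \<rightarrow>\<^sub>E {..D}. (\<Sum>s | s \<in> S \<and> g s = a. k s) * (\<Prod>i<m. x $ i ^ a i))"
    if "x \<in> carrier_vec m" for x
  proof -
    have "(\<Sum>a\<in>{..<m} \<rightarrow>\<^sub>E {..D}. (\<Sum>s | s \<in> S \<and> g s = a. k s) * (\<Prod>i<m. x $ i ^ a i)) =
      (\<Sum>a\<in>{..<m} \<rightarrow>\<^sub>E {..D}. \<Sum>s | s \<in> S \<and> g s = a. k s * (\<Prod>i<m. x $ i ^ g s i))"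
      unfolding sum_distrib_right by (intro sum.cong refl) auto
    also have "\<dots> = (\<Sum>s\<in>S. k s * (\<Prod>i<m. x $ i ^ g s i))"
      using assms(1,2) by (intro sum.group) (auto intro!: finite_PiE)
    finally show ?thesis using f that by simp
  qed
  then show ?thesis
    unfolding bounded_poly_def
    by (intro CollectI exI[of _ "\<lambda>a. \<Sum>s | s \<in> S \<and> g s = a. k s"] ballI) blast
qed

lemma bounded_polyE:
  assumes "f \<in> bounded_poly m D"
  obtains c where "\<And>x. x \<in> carrier_vec m \<Longrightarrow>
    f x = (\<Sum>a\<in>{..<m} \<rightarrow>\<^sub>E {..D}. c a * (\<Prod>i<m. x $ i ^ a i))"
  using assms unfolding bounded_poly_def by blast

lemma finite_exponents: "finite ({..<m::nat} \<rightarrow>\<^sub>E {..D::nat})"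
  by (intro finite_PiE) auto

lemma bounded_poly_cong:
  assumes "f \<in> bounded_poly m D" "\<And>x. x \<in> carrier_vec m \<Longrightarrow> f x = g x"
  shows "g \<in> bounded_poly m D"
  using assms unfolding bounded_poly_def by auto

lemma bounded_poly_mono:
  assumes "f \<in> bounded_poly m D" "D \<le> E"
  shows "f \<in> bounded_poly m E"
proof -
  obtain c where "\<And>x. x \<in> carrier_vec m \<Longrightarrow>
      f x = (\<Sum>a\<in>{..<m} \<rightarrow>\<^sub>E {..D}. c a * (\<Prod>i<m. x $ i ^ a i))"
    using assms(1) by (elim bounded_polyE) blast
  then show ?thesis
    using assms(2) by (intro bounded_polyI[where g = "\<lambda>a. a", OF finite_exponents])
      (auto simp: PiE_iff intro: order_trans)
qed

lemma bounded_poly_const: "(\<lambda>_. c) \<in> bounded_poly m D"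
  by (rule bounded_polyI[where S = "{()}" and g = "\<lambda>_. \<lambda>i\<in>{..<m}. 0" and k = "\<lambda>_. c"])
    (auto simp: PiE_iff)

lemma bounded_poly_coord:
  assumes "j < m"
  shows "(\<lambda>x. x $ j) \<in> bounded_poly m 1"
proof (rule bounded_polyI[where S = "{()}" and g = "\<lambda>_. \<lambda>i\<in>{..<m}. if i = j then 1 else 0" and k = "\<lambda>_. 1"])
  fix x :: "complex vec"
  have "(\<Prod>i<m. x $ i ^ (\<lambda>i\<in>{..<m}. if i = j then 1 else 0) i) = (\<Prod>i<m. if i = j then x $ i else 1)"
    by (intro prod.cong) auto
  then show "x $ j = (\<Sum>s\<in>{()}. 1 * (\<Prod>i<m. x $ i ^ (\<lambda>i\<in>{..<m}. if i = j then 1 else 0) i))"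
    using assms by simp
qed (auto simp: PiE_iff)

lemma bounded_poly_add:
  assumes "f \<in> bounded_poly m D" "g \<in> bounded_poly m D"
  shows "(\<lambda>x. f x + g x) \<in> bounded_poly m D"
proof -
  obtain c where c: "\<And>x. x \<in> carrier_vec m \<Longrightarrow>
      f x = (\<Sum>a\<in>{..<m} \<rightarrow>\<^sub>E {..D}. c a * (\<Prod>i<m. x $ i ^ a i))"
    using assms(1) by (elim bounded_polyE) blast
  obtain d where d: "\<And>x. x \<in> carrier_vec m \<Longrightarrow>
      g x = (\<Sum>a\<in>{..<m} \<rightarrow>\<^sub>E {..D}. d a * (\<Prod>i<m. x $ i ^ a i))"
    using assms(2) by (elim bounded_polyE) blast
  show ?thesis
    by (rule bounded_polyI[where g = "\<lambda>a. a" and k = "\<lambda>a. c a + d a", OF finite_exponents])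
      (auto simp: c d sum.distrib ring_distribs)
qed

lemma bounded_poly_mult:
  assumes "f \<in> bounded_poly m D" "g \<in> bounded_poly m E"
  shows "(\<lambda>x. f x * g x) \<in> bounded_poly m (D + E)"
proof -
  obtain c where c: "\<And>x. x \<in> carrier_vec m \<Longrightarrow>
      f x = (\<Sum>a\<in>{..<m} \<rightarrow>\<^sub>E {..D}. c a * (\<Prod>i<m. x $ i ^ a i))"
    using assms(1) by (elim bounded_polyE) blast
  obtain d where d: "\<And>x. x \<in> carrier_vec m \<Longrightarrow>
      g x = (\<Sum>a\<in>{..<m} \<rightarrow>\<^sub>E {..E}. d a * (\<Prod>i<m. x $ i ^ a i))"
    using assms(2) by (elim bounded_polyE) blast
  show ?thesis
  proof (rule bounded_polyI[where S = "({..<m} \<rightarrow>\<^sub>E {..D}) \<times> ({..<m} \<rightarrow>\<^sub>E {..E})"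
        and g = "\<lambda>(a, b). \<lambda>i\<in>{..<m}. a i + b i" and k = "\<lambda>(a, b). c a * d b"])
    fix x :: "complex vec" assume x: "x \<in> carrier_vec m"
    have "(\<Prod>i<m. x $ i ^ (\<lambda>i\<in>{..<m}. a i + b i) i) =
        (\<Prod>i<m. x $ i ^ a i) * (\<Prod>i<m. x $ i ^ b i)" for a b
      by (simp add: power_add prod.distrib)
    then show "f x * g x = (\<Sum>s\<in>({..<m} \<rightarrow>\<^sub>E {..D}) \<times> ({..<m} \<rightarrow>\<^sub>E {..E}).
        (case s of (a, b) \<Rightarrow> c a * d b) *
        (\<Prod>i<m. x $ i ^ (case s of (a, b) \<Rightarrow> \<lambda>i\<in>{..<m}. a i + b i) i))"
      unfolding c[OF x] d[OF x] sum_product sum.cartesian_product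
      by (intro sum.cong refl) (simp add: split_beta mult_ac)
  next
    fix s assume "s \<in> ({..<m} \<rightarrow>\<^sub>E {..D}) \<times> ({..<m} \<rightarrow>\<^sub>E {..E})"
    then obtain a b where s: "s = (a, b)" and "\<forall>i<m. a i \<le> D" "\<forall>i<m. b i \<le> E"
      by (auto simp: PiE_iff)
    then show "(case s of (a, b) \<Rightarrow> \<lambda>i\<in>{..<m}. a i + b i) \<in> {..<m} \<rightarrow>\<^sub>E {..D + E}"
      by (simp add: PiE_iff add_mono)
  qed (simp add: finite_exponents)
qed

lemma bounded_poly_power:
  assumes "f \<in> bounded_poly m D"
  shows "(\<lambda>x. f x ^ k) \<in> bounded_poly m (k * D)"
proof (induction k)
  case 0
  show ?case by (simp add: bounded_poly_const)
next
  case (Suc k)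
  show ?case using bounded_poly_mult[OF assms Suc.IH] by simp
qed

lemma poly_fun_bounded:
  assumes "f \<in> poly_fun m"
  shows "\<exists>D. f \<in> bounded_poly m D"
  using assms
proof induction
  case (add p q)
  then obtain D E where "p \<in> bounded_poly m D" "q \<in> bounded_poly m E" by blast
  then have "p \<in> bounded_poly m (max D E)" "q \<in> bounded_poly m (max D E)"
    by (auto intro: bounded_poly_mono)
  then show ?case by (blast intro: bounded_poly_add)
next
  case (mult p q)
  then obtain D E where "p \<in> bounded_poly m D" "q \<in> bounded_poly m E" by blast
  then show ?case using bounded_poly_mult by blast
next
  case (const c)
  show ?case using bounded_poly_const by blast
next
  case (coord i)
  then show ?case using bounded_poly_coord by blast
qed

text \<open>Gaussian elimination, one equation \<open>t\<close> at a time: a pivot \<open>j\<close>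
  with \<open>A j t \<noteq> 0\<close> removes one equation together with one unknown.\<close>

lemma exists_linear_relation:
  fixes A :: "'i \<Rightarrow> 't \<Rightarrow> 'a::field"
  assumes "finite T" "finite I" "card T < card I"
  shows "\<exists>c. (\<exists>i\<in>I. c i \<noteq> 0) \<and> (\<forall>t\<in>T. (\<Sum>i\<in>I. c i * A i t) = 0)"
  using assms
proof (induction T arbitrary: I A rule: finite_induct)
  case empty
  then have "I \<noteq> {}" by auto
  then show ?case by (intro exI[of _ "\<lambda>_. 1"]) auto
next
  case (insert t T)
  show ?case
  proof (cases "\<forall>i\<in>I. A i t = 0")
    case True
    moreover obtain c where "\<exists>i\<in>I. c i \<noteq> 0" "\<forall>t\<in>T. (\<Sum>i\<in>I. c i * A i t) = 0"
      using insert.IH[of I A] insert.prems insert.hyps by auto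
    ultimately show ?thesis by (intro exI[of _ c]) auto
  next
    case False
    then obtain j where j: "j \<in> I" "A j t \<noteq> 0" by blast
    \<comment> \<open>The coefficients after solving equation \<open>t\<close> for the unknown
      \<open>j\<close>; \<open>e\<close> below extends a solution by the value of that
      unknown.\<close>
    define B where "B i s = A i s - A i t / A j t * A j s" for i s
    have "card T < card (I - {j})"
      using insert.prems insert.hyps j by (simp add: card_Diff_singleton)
    then obtain c where c: "\<exists>i\<in>I - {j}. c i \<noteq> 0" "\<forall>s\<in>T. (\<Sum>i\<in>I - {j}. c i * B i s) = 0"
      using insert.IH[of "I - {j}" B] insert.prems by auto
    define e where "e i = (if i = j then - (\<Sum>i\<in>I - {j}. c i * A i t / A j t) else c i)" for i
    have e: "(\<Sum>i\<in>I. e i * A i s) = (\<Sum>i\<in>I - {j}. c i * B i s)" for s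
    proof -
      have "(\<Sum>i\<in>I. e i * A i s) = e j * A j s + (\<Sum>i\<in>I - {j}. e i * A i s)"
        using j insert.prems by (intro sum.remove) auto
      also have "(\<Sum>i\<in>I - {j}. e i * A i s) = (\<Sum>i\<in>I - {j}. c i * A i s)"
        by (intro sum.cong) (auto simp: e_def)
      also have "e j * A j s = - (\<Sum>i\<in>I - {j}. c i * (A i t / A j t * A j s))"
        by (simp add: e_def sum_distrib_right mult.assoc)
      finally show ?thesis by (simp add: B_def right_diff_distrib sum_subtractf mult.assoc)
    qed
    have "B i t = 0" for i using j by (simp add: B_def)
    then have "\<forall>s\<in>insert t T. (\<Sum>i\<in>I. e i * A i s) = 0"
      unfolding e using c(2) by auto
    moreover have "\<exists>i\<in>I. e i \<noteq> 0" using c(1) by (auto simp: e_def)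
    ultimately show ?thesis by blast
  qed
qed

text \<open>\<open>Suc D ^ m\<close> coefficients determine a member of
  \<open>bounded_poly m D\<close>, so a larger family of functions is linearly dependent.\<close>

lemma bounded_poly_linear_relation:
  assumes "finite I" "\<And>i. i \<in> I \<Longrightarrow> f i \<in> bounded_poly m D" "Suc D ^ m < card I"
  shows "\<exists>c. (\<exists>i\<in>I. c i \<noteq> 0) \<and> (\<forall>x\<in>carrier_vec m. (\<Sum>i\<in>I. c i * f i x) = 0)"
proof -
  let ?T = "{..<m} \<rightarrow>\<^sub>E {..D}"
  have "\<forall>i\<in>I. \<exists>A. \<forall>x\<in>carrier_vec m. f i x = (\<Sum>a\<in>?T. A a * (\<Prod>j<m. x $ j ^ a j))"
    using assms(2) unfolding bounded_poly_def by blast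
  then obtain A where A: "\<And>i x. i \<in> I \<Longrightarrow> x \<in> carrier_vec m \<Longrightarrow>
      f i x = (\<Sum>a\<in>?T. A i a * (\<Prod>j<m. x $ j ^ a j))" by metis
  have "card ?T < card I" using assms(3) by (simp add: card_PiE)
  then obtain c where c: "\<exists>i\<in>I. c i \<noteq> 0" "\<forall>a\<in>?T. (\<Sum>i\<in>I. c i * A i a) = 0"
    using exists_linear_relation[OF finite_exponents assms(1)] by blast
  have "(\<Sum>i\<in>I. c i * f i x) = 0" if x: "x \<in> carrier_vec m" for x
  proof -
    have "(\<Sum>i\<in>I. c i * f i x) = (\<Sum>i\<in>I. \<Sum>a\<in>?T. c i * A i a * (\<Prod>j<m. x $ j ^ a j))"
      by (intro sum.cong) (auto simp: A[OF _ x] sum_distrib_left mult_ac)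
    also have "\<dots> = (\<Sum>a\<in>?T. (\<Sum>i\<in>I. c i * A i a) * (\<Prod>j<m. x $ j ^ a j))"
      by (subst sum.swap) (simp add: sum_distrib_right)
    also have "\<dots> = 0" using c(2) by simp
    finally show ?thesis .
  qed
  with c(1) show ?thesis by blast
qed

subsection \<open>Dimension of parametrized images\<close>

text \<open>The monomial in \<open>p 0, \<dots>, p (r - 1)\<close> whose exponents are the base-\<open>B\<close> digits of \<open>e\<close>.\<close>

fun digit_monomial :: "(nat \<Rightarrow> 'a \<Rightarrow> complex) \<Rightarrow> nat \<Rightarrow> nat \<Rightarrow> nat \<Rightarrow> 'a \<Rightarrow> complex" where
  "digit_monomial p B 0 e x = 1"
| "digit_monomial p B (Suc r) e x = digit_monomial p B r (e mod B ^ r) x * p r x ^ (e div B ^ r)"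

lemma digit_monomial_poly_fun:
  assumes "\<And>i. i < r \<Longrightarrow> p i \<in> poly_fun k"
  shows "digit_monomial p B r e \<in> poly_fun k"
  using assms
proof (induction r arbitrary: e)
  case 0
  show ?case by (simp add: poly_fun.const)
next
  case (Suc r)
  have "(\<lambda>x. digit_monomial p B r (e mod B ^ r) x * p r x ^ (e div B ^ r)) \<in> poly_fun k"
    using Suc by (intro poly_fun.mult poly_fun_power) auto
  then show ?case by simp
qed

lemma digit_monomial_bounded:
  assumes "\<And>i. i < r \<Longrightarrow> p i \<in> bounded_poly m E" "e < B ^ r"
  shows "digit_monomial p B r e \<in> bounded_poly m (r * E * B)"
  using assms
proof (induction r arbitrary: e)
  case 0
  show ?case by (simp add: bounded_poly_const)
next
  case (Suc r)
  have "B > 0" using Suc.prems(2) by (cases B) auto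
  have "e div B ^ r < B" using Suc.prems(2) by (simp add: less_mult_imp_div_less)
  then have "(\<lambda>x. p r x ^ (e div B ^ r)) \<in> bounded_poly m (B * E)"
    using bounded_poly_power[of "p r" m E] Suc.prems
    by (meson bounded_poly_mono lessI less_imp_le mult_le_mono1)
  moreover have "digit_monomial p B r (e mod B ^ r) \<in> bounded_poly m (r * E * B)"
    using Suc \<open>B > 0\<close> by auto
  ultimately have "(\<lambda>x. digit_monomial p B r (e mod B ^ r) x * p r x ^ (e div B ^ r))
      \<in> bounded_poly m (r * E * B + B * E)"
    by (intro bounded_poly_mult)
  then show ?case by (simp add: algebra_simps)
qed

text \<open>Cancel the lowest power of \<open>p\<close> on the irreducible set \<open>C'\<close>, then restrict to \<open>C\<close>, where
  \<open>p\<close> vanishes.\<close>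

lemma coeffs_vanish_on_subset:
  assumes dom: "\<And>f g. f \<in> poly_fun k \<Longrightarrow> g \<in> poly_fun k \<Longrightarrow> (\<forall>x\<in>C'. f x * g x = 0) \<Longrightarrow>
      (\<forall>x\<in>C'. f x = 0) \<or> (\<forall>x\<in>C'. g x = 0)"
    and "C \<subseteq> C'" and p: "p \<in> poly_fun k" "\<forall>x\<in>C. p x = 0" "\<exists>x\<in>C'. p x \<noteq> 0"
    and "\<And>j. j < B \<Longrightarrow> G j \<in> poly_fun k"
    and "\<forall>x\<in>C'. (\<Sum>j<B. G j x * p x ^ j) = 0" and "j < B"
    and step: "\<And>j. j < B \<Longrightarrow> \<forall>x\<in>C. G j x = 0 \<Longrightarrow> \<forall>x\<in>C'. G j x = 0"
  shows "\<forall>x\<in>C. G j x = 0"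
  using \<open>j < B\<close>
proof (induction j rule: less_induct)
  case (less j)
  \<comment> \<open>The relation without its terms below \<open>j\<close>, divided by
    \<open>p x ^ j\<close>. Those lower coefficients vanish on \<open>C\<close> by induction, hence
    on \<open>C'\<close> by \<open>step\<close>.\<close>
  define H where "H x = (\<Sum>i\<in>{j..<B}. G i x * p x ^ (i - j))" for x
  have H: "H \<in> poly_fun k" unfolding H_def
    using assms(6) p(1) by (auto intro!: poly_fun_sum poly_fun.mult poly_fun_power)
  have "\<forall>x\<in>C'. p x ^ j * H x = 0"
  proof
    fix x assume x: "x \<in> C'"
    have "(\<Sum>i<B. G i x * p x ^ i) = (\<Sum>i<j. G i x * p x ^ i) + (\<Sum>i\<in>{j..<B}. G i x * p x ^ i)"
      using less.prems sum.atLeastLessThan_concat[of 0 j B "\<lambda>i. G i x * p x ^ i"]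
      by (simp add: atLeast0LessThan)
    also have "(\<Sum>i<j. G i x * p x ^ i) = 0"
    proof (intro sum.neutral ballI)
      fix i assume "i \<in> {..<j}"
      then have "i < j" "i < B" using less.prems by auto
      then have "G i x = 0" using step[OF _ less.IH] x by blast
      then show "G i x * p x ^ i = 0" by simp
    qed
    also have "(\<Sum>i\<in>{j..<B}. G i x * p x ^ i) = p x ^ j * H x"
      unfolding H_def sum_distrib_left
    proof (intro sum.cong refl)
      fix i assume "i \<in> {j..<B}"
      then show "G i x * p x ^ i = p x ^ j * (G i x * p x ^ (i - j))"
        using power_add[of "p x" j "i - j"] by simp
    qed
    finally show "p x ^ j * H x = 0" using assms(7) x by simp
  qed
  \<comment> \<open>By \<open>dom\<close>, the factor \<open>p x ^ j\<close>, not identically zero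
    on \<open>C'\<close>, can be cancelled.\<close>
  moreover have "\<exists>x\<in>C'. p x ^ j \<noteq> 0" using p(3) by auto
  ultimately have "\<forall>x\<in>C'. H x = 0"
    using dom[OF poly_fun_power[OF p(1)] H] by blast
  moreover have "H x = G j x" if "x \<in> C" for x
  proof -
    \<comment> \<open>On \<open>C\<close> the function \<open>p\<close> vanishes, so only the term
      with exponent zero remains.\<close>
    have "H x = (\<Sum>i\<in>{j..<B}. if i = j then G j x else 0)"
      unfolding H_def using p(2) that by (intro sum.cong) (auto simp: power_0_left)
    then show ?thesis using less.prems by simp
  qed
  ultimately show ?case using \<open>C \<subseteq> C'\<close> by (metis subsetD)
qed

text \<open>Grouping by the top digit turns the relation into a polynomial in the last function of
  the family, whose coefficients involve only the earlier ones. By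
  \<open>coeffs_vanish_on_subset\<close> these coefficients vanish on the previous member of the
  chain, where the induction hypothesis applies.\<close>

lemma digit_monomials_independent:
  assumes dom: "\<And>i f g. i \<le> r \<Longrightarrow> f \<in> poly_fun k \<Longrightarrow> g \<in> poly_fun k \<Longrightarrow>
      (\<forall>x\<in>C i. f x * g x = 0) \<Longrightarrow> (\<forall>x\<in>C i. f x = 0) \<or> (\<forall>x\<in>C i. g x = 0)"
    and C: "C 0 \<noteq> {}" "\<And>i. i < r \<Longrightarrow> C i \<subseteq> C (Suc i)"
    and p: "\<And>i. i < r \<Longrightarrow> p i \<in> poly_fun k" "\<And>i. i < r \<Longrightarrow> \<forall>x\<in>C i. p i x = 0"
      "\<And>i. i < r \<Longrightarrow> \<exists>x\<in>C (Suc i). p i x \<noteq> 0"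
    and rel: "\<forall>x\<in>C r. (\<Sum>e<B ^ r. c e * digit_monomial p B r e x) = 0"
    and e: "e < B ^ r"
  shows "c e = 0"
  using assms
proof (induction r arbitrary: c e)
  case 0
  then show ?case by auto
next
  case (Suc r)
  define G where "G j x = (\<Sum>e<B ^ r. c (e + j * B ^ r) * digit_monomial p B r e x)" for j x
  have Bpos: "B ^ r > 0" using Suc.prems(8) by (cases "B = 0") auto
  have IH: "c (e + j * B ^ r) = 0" if "\<forall>x\<in>C r. G j x = 0" "e < B ^ r" for e j
  proof (rule Suc.IH[where c = "\<lambda>e. c (e + j * B ^ r)"])
    show "(\<forall>x\<in>C i. f x = 0) \<or> (\<forall>x\<in>C i. g x = 0)"
      if "i \<le> r" "f \<in> poly_fun k" "g \<in> poly_fun k" "\<forall>x\<in>C i. f x * g x = 0" for i f g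
      using Suc.prems(1)[of i f g] that by auto
    show "\<forall>x\<in>C r. (\<Sum>e<B ^ r. c (e + j * B ^ r) * digit_monomial p B r e x) = 0"
      using that(1) by (simp add: G_def)
  qed (use Suc.prems(2-6) that in \<open>simp_all add: less_SucI\<close>)
  have dG: "G j \<in> poly_fun k" for j
    unfolding G_def using Suc.prems(4)
    by (auto intro!: poly_fun_sum poly_fun.mult poly_fun.const digit_monomial_poly_fun)
  have "\<forall>x\<in>C r. G j x = 0" if "j < B" for j
  proof (rule coeffs_vanish_on_subset[where C = "C r" and C' = "C (Suc r)" and p = "p r" and k = k and B = B])
    show "\<forall>x\<in>C (Suc r). (\<Sum>j<B. G j x * p r x ^ j) = 0"
    proof
      fix x assume x: "x \<in> C (Suc r)"
      \<comment> \<open>The range below \<open>B ^ Suc r\<close> splits into \<open>B\<close> blocks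
        of length \<open>B ^ r\<close>, one for each top digit \<open>j\<close>.\<close>
      have "(\<Sum>j<B. G j x * p r x ^ j) =
          (\<Sum>j<B. \<Sum>e\<in>{j * B ^ r..<j * B ^ r + B ^ r}. c e * digit_monomial p B (Suc r) e x)"
      proof (rule sum.cong[OF refl])
        fix j
        have "(\<Sum>e\<in>{j * B ^ r..<j * B ^ r + B ^ r}. c e * digit_monomial p B (Suc r) e x) =
           (\<Sum>e<B ^ r. c (e + j * B ^ r) * digit_monomial p B (Suc r) (e + j * B ^ r) x)"
          using sum.shift_bounds_nat_ivl[of "\<lambda>e. c e * digit_monomial p B (Suc r) e x" 0 "j * B ^ r" "B ^ r"]
          by (simp add: atLeast0LessThan add.commute)
        also have "\<dots> = G j x * p r x ^ j"
          unfolding G_def sum_distrib_right using Bpos by (intro sum.cong) auto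
        finally show "G j x * p r x ^ j = (\<Sum>e\<in>{j * B ^ r..<j * B ^ r + B ^ r}. c e * digit_monomial p B (Suc r) e x)" ..
      qed
      also have "\<dots> = (\<Sum>e<B ^ Suc r. c e * digit_monomial p B (Suc r) e x)"
        unfolding sum.nat_group by simp
      finally show "(\<Sum>j<B. G j x * p r x ^ j) = 0" using Suc.prems(7) x by simp
    qed
    \<comment> \<open>If \<open>G j\<close> vanishes on the smaller set, the induction hypothesis
      makes all its constants zero, so it vanishes everywhere.\<close>
    show "\<forall>x\<in>C (Suc r). G j x = 0" if "\<forall>x\<in>C r. G j x = 0" for j
      unfolding G_def using IH[OF that] by simp
    show "(\<forall>x\<in>C (Suc r). f x = 0) \<or> (\<forall>x\<in>C (Suc r). g x = 0)"
      if "f \<in> poly_fun k" "g \<in> poly_fun k" "\<forall>x\<in>C (Suc r). f x * g x = 0" for f g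
      using Suc.prems(1)[OF le_refl that] .
  qed (use Suc.prems(3-6) dG that in simp_all)
  moreover have "e div B ^ r < B" using Suc.prems(8) by (simp add: less_mult_imp_div_less)
  ultimately have "c (e mod B ^ r + (e div B ^ r) * B ^ r) = 0"
    using Bpos by (intro IH) auto
  then show ?case by (simp add: mod_mult_div_eq mult.commute)
qed

text \<open>The zero sets of \<open>f\<close> and \<open>g\<close> cover \<open>S\<close>;
  intersected with \<open>Z\<close> they are closed in the subspace, so irreducibility picks one of
  them.\<close>

lemma irreducible_in_closed_subspace:
  assumes irr: "irreducible_in (subtopology (zariski k) Z) S" and Z: "closedin (zariski k) Z"
    and fg: "f \<in> poly_fun k" "g \<in> poly_fun k" "\<forall>x\<in>S. f x * g x = 0"
  shows "(\<forall>x\<in>S. f x = 0) \<or> (\<forall>x\<in>S. g x = 0)"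
proof -
  have S: "S \<subseteq> carrier_vec k" "S \<subseteq> Z"
    using irr by (auto simp: irreducible_in_def topspace_zariski)
  have "closedin (subtopology (zariski k) Z) (Z \<inter> zero_set k {h})" if "h \<in> poly_fun k" for h
    using that by (intro closedin_subtopology_Int_closed) (auto simp: closedin_zariski)
  moreover have "S \<subseteq> (Z \<inter> zero_set k {f}) \<union> (Z \<inter> zero_set k {g})"
    using S fg(3) by (auto simp: zero_set_def)
  ultimately have "S \<subseteq> Z \<inter> zero_set k {f} \<or> S \<subseteq> Z \<inter> zero_set k {g}"
    using irr fg(1,2) unfolding irreducible_in_def by blast
  then show ?thesis by (auto simp: zero_set_def)
qed

text \<open>A containment of images suffices: a polynomial relation that holds on the image of
  \<psi> holds on that of \<phi> and hence on its Zariski closure, where the chain lies.\<close>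

lemma covariant_dim_le:
  assumes \<psi>: "poly_map d k \<psi>" and img: "\<phi> ` carrier_vec m \<subseteq> \<psi> ` carrier_vec d"
  shows "covariant_dim m k \<phi> \<le> enat d"
  unfolding covariant_dim_def krull_dim_def
proof (rule Sup_least, clarify)
  fix r and C :: "nat \<Rightarrow> complex vec set"
  let ?Z = "zariski k closure_of (\<phi> ` carrier_vec m)"
  assume C: "\<forall>i\<le>r. closedin (subtopology (zariski k) ?Z) (C i) \<and>
      irreducible_in (subtopology (zariski k) ?Z) (C i)"
    and chain: "\<forall>i<r. C i \<subset> C (Suc i)"
  have clC: "closedin (zariski k) (C i)" "C i \<subseteq> ?Z" "C i \<subseteq> carrier_vec k" if "i \<le> r" for i
    using C that closedin_subset[of "zariski k"]
    by (auto simp: closedin_closed_subtopology topspace_zariski)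
  have "\<exists>p\<in>poly_fun k. (\<forall>x\<in>C i. p x = 0) \<and> (\<exists>x\<in>C (Suc i). p x \<noteq> 0)" if i: "i < r" for i
  proof -
    obtain S where S: "S \<subseteq> poly_fun k" "C i = zero_set k S"
      using clC(1)[of i] i by (auto simp: closedin_zariski)
    obtain x where x: "x \<in> C (Suc i)" "x \<notin> C i" using chain i by blast
    moreover have "x \<in> carrier_vec k" using clC(3)[of "Suc i"] x i by auto
    ultimately obtain p where "p \<in> S" "p x \<noteq> 0" using S(2) by (auto simp: zero_set_def)
    then show ?thesis using S x(1) by (intro bexI[of _ p]) (auto simp: zero_set_def)
  qed
  then obtain p where p: "\<And>i. i < r \<Longrightarrow> p i \<in> poly_fun k"
    "\<And>i. i < r \<Longrightarrow> \<forall>x\<in>C i. p i x = 0" "\<And>i. i < r \<Longrightarrow> \<exists>x\<in>C (Suc i). p i x \<noteq> 0"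
    by metis
  have "\<exists>D. (\<lambda>x. p i (\<psi> x)) \<in> bounded_poly d D" if "i < r" for i
    using poly_fun_compose[OF p(1)[OF that] \<psi>] poly_fun_bounded bounded_poly_cong
    by (metis (mono_tags, lifting))
  then obtain E where E: "\<And>i. i < r \<Longrightarrow> (\<lambda>x. p i (\<psi> x)) \<in> bounded_poly d (E i)" by metis
  define F where "F = (\<Sum>i<r. E i)"
  have F: "(\<lambda>x. p i (\<psi> x)) \<in> bounded_poly d F" if "i < r" for i
    using E[OF that] that unfolding F_def
    by (auto intro!: bounded_poly_mono[OF E[OF that]] member_le_sum)
  have "r \<le> d"
  proof (rule ccontr)
    assume "\<not> r \<le> d"
    \<comment> \<open>Chosen larger than \<open>Suc (r * F) ^ d\<close>: then the
      \<open>B ^ r \<ge> B ^ Suc d\<close> digit monomials outnumber the at most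
      \<open>(Suc (r * F) * B) ^ d\<close> coefficients available to them after composition with
      \<psi>.\<close>
    define B where "B = Suc (Suc (r * F) ^ d)"
    let ?q = "\<lambda>i x. p i (\<psi> x)"
    have comp: "digit_monomial ?q B s e x = digit_monomial p B s e (\<psi> x)" for s e x
      by (induction s arbitrary: e) auto
    have "Suc (r * F * B) ^ d \<le> (Suc (r * F) * B) ^ d"
      by (intro power_mono) (auto simp: B_def)
    also have "\<dots> = Suc (r * F) ^ d * B ^ d" by (simp only: power_mult_distrib)
    also have "\<dots> < B * B ^ d" by (intro mult_strict_right_mono) (auto simp: B_def)
    also have "\<dots> = B ^ Suc d" by simp
    also have "\<dots> \<le> B ^ r" using \<open>\<not> r \<le> d\<close> by (intro power_increasing) (auto simp: B_def)
    finally have "Suc (r * F * B) ^ d < card {..<B ^ r}" by simp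
    from bounded_poly_linear_relation[OF _ _ this, of "digit_monomial ?q B r"]
    obtain c where c: "\<exists>e<B ^ r. c e \<noteq> 0"
      "\<forall>x\<in>carrier_vec d. (\<Sum>e<B ^ r. c e * digit_monomial p B r e (\<psi> x)) = 0"
      using digit_monomial_bounded[of r ?q d F _ B] F by (auto simp: comp)
    let ?R = "\<lambda>y. \<Sum>e<B ^ r. c e * digit_monomial p B r e y"
    have R: "?R \<in> poly_fun k"
      using p(1) by (intro poly_fun_sum poly_fun.mult poly_fun.const digit_monomial_poly_fun) auto
    have "\<psi> ` carrier_vec d \<subseteq> carrier_vec k" using \<psi> by (auto simp: poly_map_def)
    then have "\<phi> ` carrier_vec m \<subseteq> zero_set k {?R}"
      using img c(2) by (fastforce simp: zero_set_def)
    then have "?Z \<subseteq> zero_set k {?R}"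
      using R by (intro closure_of_minimal) (auto simp: closedin_zariski)
    then have R0: "\<forall>x\<in>C r. ?R x = 0" using clC(2)[of r] by (auto simp: zero_set_def)
    have C0: "C 0 \<noteq> {}" using C by (auto simp: irreducible_in_def)
    have "c e = 0" if "e < B ^ r" for e
    proof (rule digit_monomials_independent[where C = C and k = k and p = p and B = B and r = r])
      show "(\<forall>x\<in>C i. f x = 0) \<or> (\<forall>x\<in>C i. g x = 0)"
        if "i \<le> r" "f \<in> poly_fun k" "g \<in> poly_fun k" "\<forall>x\<in>C i. f x * g x = 0" for i f g
        using irreducible_in_closed_subspace[OF _ closedin_closure_of that(2-4)] C that(1) by blast
    qed (use p chain that R0 C0 in auto)
    with c(1) show False by blast
  qed
  then show "enat r \<le> enat d" by simp
qed

subsection \<open>Permutation modules\<close>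

locale index_action = group G for G (structure) +
  fixes m :: nat and \<pi> :: "'a \<Rightarrow> nat \<Rightarrow> nat"
  assumes action_closed: "g \<in> carrier G \<Longrightarrow> i < m \<Longrightarrow> \<pi> g i < m"
    and action_one: "i < m \<Longrightarrow> \<pi> \<one> i = i"
    and action_mult: "g \<in> carrier G \<Longrightarrow> h \<in> carrier G \<Longrightarrow> i < m \<Longrightarrow> \<pi> (g \<otimes> h) i = \<pi> g (\<pi> h i)"
begin

definition perm_rep :: "'a \<Rightarrow> complex mat" where
  "perm_rep g = mat m m (\<lambda>(i, j). if i = \<pi> g j then 1 else 0)"

lemma action_eq_iff:
  assumes "g \<in> carrier G" "i < m" "j < m"
  shows "i = \<pi> g j \<longleftrightarrow> j = \<pi> (inv g) i"
proof -
  have "\<pi> (inv g) (\<pi> g j) = j" "\<pi> g (\<pi> (inv g) i) = i"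
    using assms action_mult[of "inv g" g j] action_mult[of g "inv g" i] action_one by auto
  then show ?thesis by auto
qed

lemma action_bij_betw:
  assumes "g \<in> carrier G"
  shows "bij_betw (\<pi> g) {..<m} {..<m}"
proof (rule bij_betw_byWitness[where f' = "\<pi> (inv g)"])
  show "\<forall>j\<in>{..<m}. \<pi> (inv g) (\<pi> g j) = j" "\<forall>j\<in>{..<m}. \<pi> g (\<pi> (inv g) j) = j"
    using assms action_eq_iff action_closed inv_closed by (metis lessThan_iff)+
qed (use assms action_closed in auto)

text \<open>\<open>perm_rep g\<close> sends basis vector \<open>j\<close> to basis vector
  \<open>\<pi> g j\<close>, so coordinate \<open>i\<close> of the result is read off at the preimage
  of \<open>i\<close>.\<close>

lemma perm_rep_mult_vec:
  assumes "g \<in> carrier G" "v \<in> carrier_vec m"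
  shows "perm_rep g *\<^sub>v v = vec m (\<lambda>i. v $ \<pi> (inv g) i)"
proof (rule eq_vecI)
  fix i assume "i < dim_vec (vec m (\<lambda>i. v $ \<pi> (inv g) i))"
  then have i: "i < m" by simp
  then have "(perm_rep g *\<^sub>v v) $ i = (\<Sum>j = 0..<m. (if i = \<pi> g j then 1 else 0) * v $ j)"
    using assms by (simp add: perm_rep_def scalar_prod_def)
  also have "\<dots> = (\<Sum>j = 0..<m. if j = \<pi> (inv g) i then v $ j else 0)"
    by (intro sum.cong) (simp_all add: action_eq_iff[OF assms(1) i])
  also have "\<dots> = v $ \<pi> (inv g) i" using assms(1) i action_closed by simp
  finally show "(perm_rep g *\<^sub>v v) $ i = vec m (\<lambda>i. v $ \<pi> (inv g) i) $ i" using i by simp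
qed (simp add: perm_rep_def)

lemma perm_rep_mult:
  assumes "g \<in> carrier G" "h \<in> carrier G"
  shows "perm_rep (g \<otimes> h) = perm_rep g * perm_rep h"
proof (rule eq_matI)
  fix i j assume "i < dim_row (perm_rep g * perm_rep h)" "j < dim_col (perm_rep g * perm_rep h)"
  then have ij: "i < m" "j < m" by (simp_all add: perm_rep_def)
  then have "(perm_rep g * perm_rep h) $$ (i, j) =
      (\<Sum>k = 0..<m. (if i = \<pi> g k then 1 else 0) * (if k = \<pi> h j then 1 else 0))"
    by (simp add: perm_rep_def scalar_prod_def)
  also have "\<dots> = (\<Sum>k = 0..<m. if k = \<pi> h j then (if i = \<pi> g k then 1 else 0) else 0)"
    by (intro sum.cong) auto
  also have "\<dots> = perm_rep (g \<otimes> h) $$ (i, j)"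
    using assms ij action_closed[of h j] by (simp add: perm_rep_def action_mult)
  finally show "perm_rep (g \<otimes> h) $$ (i, j) = (perm_rep g * perm_rep h) $$ (i, j)" ..
qed (simp_all add: perm_rep_def)

lemma is_module_perm_rep: "is_module G m perm_rep"
proof -
  have one: "perm_rep \<one> = 1\<^sub>m m"
    by (rule eq_matI) (auto simp: perm_rep_def action_one)
  have carr: "perm_rep g \<in> carrier_mat m m" for g by (simp add: perm_rep_def)
  have "perm_rep g \<in> Units (ring_mat TYPE(complex) m ())" if g: "g \<in> carrier G" for g
    using perm_rep_mult[of g "inv g"] perm_rep_mult[of "inv g" g] g
    by (auto simp: Units_def ring_mat_def carr one intro!: bexI[of _ "perm_rep (inv g)"])
  then show ?thesis
    by (auto simp: is_module_def hom_def GL_def units_of_def ring_mat_def perm_rep_mult)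
qed

end

text \<open>\<open>sym_group n\<close> permutes \<open>{1..n}\<close> while coordinates are indexed
  from 0, hence the shift by one.\<close>

lemma index_action_sym_group: "index_action (sym_group n) n (\<lambda>p i. p (Suc i) - 1)"
proof -
  have range: "p (Suc i) \<in> {1..n}" if "p permutes {1..n}" "i < n" for p i
    using that permutes_in_image[of p "{1..n}" "Suc i"] by simp
  interpret group "sym_group n" by (rule sym_group_is_group)
  show ?thesis
  proof
    fix p q i assume p: "p \<in> carrier (sym_group n)" and i: "i < n"
    show "p (Suc i) - 1 < n"
      using range[of p i] p i by (auto simp: sym_group_carrier)
    assume "q \<in> carrier (sym_group n)"
    then have "Suc (q (Suc i) - 1) = q (Suc i)"
      using range[of q i] i by (auto simp: sym_group_carrier)
    then show "(p \<otimes>\<^bsub>sym_group n\<^esub> q) (Suc i) - 1 = p (Suc (q (Suc i) - 1)) - 1"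
      by (simp add: sym_group_mult)
  qed (simp add: sym_group_one)
qed

section \<open>The action on ordered pairs of indices\<close>

lemma div_mod_less:
  fixes e n :: nat
  assumes "e < n * n"
  shows "e div n < n" "e mod n < n"
  using assms by (auto simp: less_mult_imp_div_less intro!: mod_less_divisor gr0I)

lemma pair_index_less:
  fixes a b n :: nat
  assumes "a < n" "b < n"
  shows "a * n + b < n * n"
proof -
  have "a * n + b < Suc a * n" using assms by simp
  also have "\<dots> \<le> n * n" using assms by (intro mult_right_mono) auto
  finally show ?thesis .
qed

lemma (in index_action) index_action_pairs:
  "index_action G (m * m) (\<lambda>g e. \<pi> g (e div m) * m + \<pi> g (e mod m))"
proof
  fix e assume "e < m * m"
  note e = div_mod_less[OF this]
  show "\<pi> \<one> (e div m) * m + \<pi> \<one> (e mod m) = e" using e by (simp add: action_one)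
  fix g assume g: "g \<in> carrier G"
  show "\<pi> g (e div m) * m + \<pi> g (e mod m) < m * m"
    using e g by (intro pair_index_less action_closed)
  fix h assume h: "h \<in> carrier G"
  have "\<pi> h (e mod m) < m" using e h by (intro action_closed)
  then show "\<pi> (g \<otimes> h) (e div m) * m + \<pi> (g \<otimes> h) (e mod m) =
      \<pi> g ((\<pi> h (e div m) * m + \<pi> h (e mod m)) div m) * m +
      \<pi> g ((\<pi> h (e div m) * m + \<pi> h (e mod m)) mod m)"
    using e g h by (simp add: action_mult)
qed

subsection \<open>Products of differences\<close>

text \<open>For \<open>d i j = x i - x j\<close> this is, up to sign, the discriminant of the points
  \<open>x i\<close>. Keeping \<open>d\<close> abstract lets the same products be formed from
  \<open>bracket\<close>.\<close>

definition gap_prod :: "nat set \<Rightarrow> (nat \<Rightarrow> nat \<Rightarrow> 'a::field) \<Rightarrow> 'a" where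
  "gap_prod A d = (\<Prod>i\<in>A. \<Prod>j\<in>A - {i}. d i j)"

text \<open>The exponent is chosen such that every index occurs in \<open>2 * (card A - 3)\<close> factors; this makes
  the product a semi-invariant of Moebius transformations.\<close>

definition edge_prod :: "nat set \<Rightarrow> nat \<Rightarrow> nat \<Rightarrow> (nat \<Rightarrow> nat \<Rightarrow> 'a::field) \<Rightarrow> 'a" where
  "edge_prod A a b d = d a b ^ (2 * (card A - 3)) * gap_prod (A - {a, b}) d"

lemma gap_prod_cong:
  assumes "\<And>i j. i \<in> A \<Longrightarrow> j \<in> A \<Longrightarrow> i \<noteq> j \<Longrightarrow> d i j = d' i j"
  shows "gap_prod A d = gap_prod A d'"
  unfolding gap_prod_def using assms by (intro prod.cong) auto

lemma edge_prod_cong: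
  assumes "\<And>i j. i \<in> A \<Longrightarrow> j \<in> A \<Longrightarrow> d i j = d' i j" "a \<in> A" "b \<in> A"
  shows "edge_prod A a b d = edge_prod A a b d'"
proof -
  have "gap_prod (A - {a, b}) d = gap_prod (A - {a, b}) d'"
    using assms(1) by (intro gap_prod_cong) auto
  then show ?thesis using assms by (simp add: edge_prod_def)
qed

lemma gap_prod_eq_0_iff:
  assumes "finite A"
  shows "gap_prod A d = 0 \<longleftrightarrow> (\<exists>i\<in>A. \<exists>j\<in>A. i \<noteq> j \<and> d i j = 0)"
proof -
  have "gap_prod A d = 0 \<longleftrightarrow> (\<exists>i\<in>A. \<exists>j\<in>A - {i}. d i j = 0)"
    using assms by (simp add: gap_prod_def)
  then show ?thesis by (metis Diff_iff singleton_iff)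
qed

lemma gap_prod_image:
  assumes "inj_on q A"
  shows "gap_prod (q ` A) d = gap_prod A (\<lambda>i j. d (q i) (q j))"
proof -
  have "(\<Prod>j\<in>q ` A - {q i}. d (q i) j) = (\<Prod>j\<in>A - {i}. d (q i) (q j))" if "i \<in> A" for i
  proof -
    have "q ` A - {q i} = q ` (A - {i})" using assms that by (auto simp: inj_on_def)
    moreover have "inj_on q (A - {i})" using assms by (rule inj_on_subset) auto
    ultimately show ?thesis by (simp add: prod.reindex)
  qed
  then show ?thesis using assms by (simp add: gap_prod_def prod.reindex)
qed

lemma edge_prod_image:
  assumes "bij_betw q A A" "a \<in> A" "b \<in> A"
  shows "edge_prod A (q a) (q b) d = edge_prod A a b (\<lambda>i j. d (q i) (q j))"
proof -
  have "A - {q a, q b} = q ` (A - {a, b})"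
    using assms by (auto simp: bij_betw_def inj_on_def)
  moreover have "inj_on q (A - {a, b})" using assms(1) by (auto simp: bij_betw_def intro: inj_on_subset)
  ultimately show ?thesis by (simp add: edge_prod_def gap_prod_image)
qed

text \<open>Every \<open>l i\<close> occurs \<open>card A - 1\<close> times through the first index
  and as often through the second.\<close>

lemma gap_prod_scale:
  assumes "finite A"
  shows "gap_prod A (\<lambda>i j. l i * l j * d i j) = (\<Prod>i\<in>A. l i) ^ (2 * (card A - 1)) * gap_prod A d"
proof -
  have 1: "(\<Prod>i\<in>A. \<Prod>j\<in>A - {i}. l i) = (\<Prod>i\<in>A. l i) ^ (card A - 1)"
    using assms by (simp add: card_Diff_singleton prod_power_distrib)
  have "A - {i} = {j. j \<in> A \<and> i \<noteq> j}" "A - {i} = {j. j \<in> A \<and> j \<noteq> i}" for i by auto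
  then have 2: "(\<Prod>i\<in>A. \<Prod>j\<in>A - {i}. l j) = (\<Prod>i\<in>A. l i) ^ (card A - 1)"
    using prod.swap_restrict[OF assms assms, of "\<lambda>i j. l j" "(\<noteq>)"] 1 by simp
  show ?thesis
    unfolding gap_prod_def prod.distrib 1 2 by (simp add: mult_2 power_add)
qed

text \<open>For distinct \<open>a\<close> and \<open>b\<close>, these two indices get their factors
  from the power of \<open>d a b\<close>, the others from \<open>gap_prod\<close> over
  \<open>card A - 2\<close> indices; both exponents are \<open>2 * (card A - 3)\<close>.\<close>

lemma edge_prod_scale:
  assumes "finite A" "card A > 3" "a \<in> A" "b \<in> A" "\<And>i. d i i = 0"
  shows "edge_prod A a b (\<lambda>i j. l i * l j * d i j) = (\<Prod>i\<in>A. l i) ^ (2 * (card A - 3)) * edge_prod A a b d"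
proof (cases "a = b")
  \<comment> \<open>Both sides vanish, as \<open>d a a = 0\<close> and the exponent
    \<open>2 * (card A - 3)\<close> is positive.\<close>
  case True
  then show ?thesis using assms by (simp add: edge_prod_def power_0_left)
next
  case False
  have A: "A = insert a (insert b (A - {a, b}))" using assms by auto
  have "(\<Prod>i\<in>A. l i) = l a * l b * (\<Prod>i\<in>A - {a, b}. l i)"
    using assms(1) False by (subst A) (simp add: mult.assoc)
  moreover have "card (A - {a, b}) - 1 = card A - 3"
    using assms False by (simp add: card_Diff_subset)
  ultimately show ?thesis
    using assms(1) by (simp add: edge_prod_def gap_prod_scale power_mult_distrib)
qed

subsection \<open>Normalizing three points\<close>

text \<open>The differences of the points \<open>\<infinity>, y 1, y 2, \<dots>\<close> of the projective line, with \<open>\<infinity>\<close>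
  represented by the vector \<open>(1, 0)\<close>.\<close>

definition bracket :: "(nat \<Rightarrow> 'a::field) \<Rightarrow> nat \<Rightarrow> nat \<Rightarrow> 'a" where
  "bracket y i j = (if i = j then 0 else if i = 0 then 1 else if j = 0 then -1 else y i - y j)"

text \<open>The Moebius transformation mapping \<open>x 0, x 1, x 2\<close> to \<open>\<infinity>, 0, 1\<close>; the scaling factors come
  from lifting it to a linear map of the plane.\<close>

lemma exists_normal_form:
  fixes x :: "nat \<Rightarrow> complex"
  assumes inj: "inj_on x {..<n}" and n: "n \<ge> 3"
  obtains y l where "y 1 = 0" "y 2 = 1"
    "\<And>i j. i < n \<Longrightarrow> j < n \<Longrightarrow> x i - x j = l i * l j * bracket y i j"
proof -
  have ne: "x i \<noteq> x j" if "i < n" "j < n" "i \<noteq> j" for i j using inj that by (auto simp: inj_on_def)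
  have ne3: "x 0 \<noteq> x 1" "x 0 \<noteq> x 2" "x 1 \<noteq> x 2" using ne n by auto
  define c where "c = (x 0 - x 2) / (x 2 - x 1)"
  define y where "y i = c * (x i - x 1) / (x 0 - x i)" for i
  \<comment> \<open>The constant \<open>c\<close> normalizes \<open>y 2\<close> to 1. For nonzero
    indices \<open>y i - y j\<close> is \<open>c * (x 0 - x 1) * (x i - x j)\<close> divided by
    \<open>(x 0 - x i) * (x 0 - x j)\<close>, and \<open>K\<close> enters \<open>l i * l j\<close>
    quadratically, hence the square root.\<close>
  define K where "K = csqrt (c * (x 0 - x 1))"
  define l where "l i = (if i = 0 then K else (x 0 - x i) / K)" for i
  have K: "K \<noteq> 0" "K * K = c * (x 0 - x 1)"
    using ne3 by (auto simp: K_def c_def simp flip: power2_eq_square)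
  show thesis
  proof (rule that[of y l])
    show "y 1 = 0" "y 2 = 1" using ne3 by (auto simp: y_def c_def)
    fix i j assume ij: "i < n" "j < n"
    show "x i - x j = l i * l j * bracket y i j"
    proof (cases "i = j \<or> i = 0 \<or> j = 0")
      case True
      then show ?thesis using K(1) by (auto simp: bracket_def l_def)
    next
      case False
      then have "x 0 - x i \<noteq> 0" "x 0 - x j \<noteq> 0" using ne[of 0 i] ne[of 0 j] ij by auto
      then have "(x 0 - x i) * (x 0 - x j) * (y i - y j) = K * K * (x i - x j)"
        unfolding K(2) y_def by (simp add: divide_simps) (simp add: algebra_simps)
      then have "(x 0 - x i) * (x 0 - x j) * (y i - y j) / (K * K) = x i - x j"
        using K(1) by simp
      then show ?thesis using False by (simp add: bracket_def l_def)
    qed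
  qed
qed

subsection \<open>The covariant\<close>

definition pair_cov :: "nat \<Rightarrow> complex vec \<Rightarrow> complex vec" where
  "pair_cov n v = vec (n * n) (\<lambda>e. gap_prod {..<n} (\<lambda>i j. v $ i - v $ j) *
     edge_prod {..<n} (e div n) (e mod n) (\<lambda>i j. v $ i - v $ j))"

text \<open>Coordinate 0 of \<open>w\<close> is the common factor, coordinates 1 to
  \<open>n - 3\<close> are the points 3 to \<open>n - 1\<close>. \<open>bracket\<close> places point
  0 at infinity without reading its value.\<close>

definition pair_param :: "nat \<Rightarrow> complex vec \<Rightarrow> complex vec" where
  "pair_param n w = (let d = bracket (\<lambda>i. if i = 1 then 0 else if i = 2 then 1 else w $ (i - 2)) in
     vec (n * n) (\<lambda>e. w $ 0 * (gap_prod {..<n} d * edge_prod {..<n} (e div n) (e mod n) d)))"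

lemma poly_fun_gap_prod:
  assumes "\<And>i j. i \<in> A \<Longrightarrow> j \<in> A \<Longrightarrow> (\<lambda>x. d x i j) \<in> poly_fun m"
  shows "(\<lambda>x. gap_prod A (d x)) \<in> poly_fun m"
  unfolding gap_prod_def using assms by (intro poly_fun_prod) auto

lemma poly_fun_edge_prod:
  assumes "\<And>i j. i \<in> A \<Longrightarrow> j \<in> A \<Longrightarrow> (\<lambda>x. d x i j) \<in> poly_fun m" "a \<in> A" "b \<in> A"
  shows "(\<lambda>x. edge_prod A a b (d x)) \<in> poly_fun m"
  unfolding edge_prod_def using assms
  by (intro poly_fun.mult poly_fun_power poly_fun_gap_prod) auto

lemma poly_map_pair_cov: "poly_map n (n * n) (pair_cov n)"
  unfolding poly_map_def
proof (intro conjI allI impI)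
  fix e assume e: "e < n * n"
  have "(\<lambda>v. gap_prod {..<n} (\<lambda>i j. v $ i - v $ j) *
     edge_prod {..<n} (e div n) (e mod n) (\<lambda>i j. v $ i - v $ j)) \<in> poly_fun n"
    using div_mod_less[OF e]
    by (intro poly_fun.mult poly_fun_gap_prod poly_fun_edge_prod poly_fun_diff poly_fun.coord) auto
  then show "\<exists>p\<in>poly_fun n. \<forall>x\<in>carrier_vec n. pair_cov n x $ e = p x"
    using e by (intro bexI) (auto simp: pair_cov_def)
qed (auto simp: pair_cov_def)

lemma poly_map_pair_param:
  assumes "n \<ge> 3"
  shows "poly_map (n - 2) (n * n) (pair_param n)"
  unfolding poly_map_def
proof (intro conjI allI impI)
  fix e assume e: "e < n * n"
  let ?y = "\<lambda>w::complex vec. \<lambda>i. if i = 1 then 0 else if i = 2 then 1 else w $ (i - 2)"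
  \<comment> \<open>For \<open>i = 0\<close> truncated subtraction yields coordinate 0, which exists
    because \<open>n \<ge> 3\<close>.\<close>
  have y: "(\<lambda>w. ?y w i) \<in> poly_fun (n - 2)" if "i < n" for i
    using that assms by (cases "i = 1 \<or> i = 2") (auto intro: poly_fun.const poly_fun.coord)
  have d: "(\<lambda>w. bracket (?y w) i j) \<in> poly_fun (n - 2)" if "i < n" "j < n" for i j
    using poly_fun_diff[OF y[OF that(1)] y[OF that(2)]]
    by (cases "i = j"; cases "i = 0"; cases "j = 0") (simp_all add: bracket_def poly_fun.const)
  have "(\<lambda>w. w $ 0 * (gap_prod {..<n} (bracket (?y w)) *
     edge_prod {..<n} (e div n) (e mod n) (bracket (?y w)))) \<in> poly_fun (n - 2)"
    using div_mod_less[OF e] assms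
    by (intro poly_fun.mult poly_fun_gap_prod poly_fun_edge_prod d poly_fun.coord) auto
  then show "\<exists>p\<in>poly_fun (n - 2). \<forall>x\<in>carrier_vec (n - 2). pair_param n x $ e = p x"
    using e by (intro bexI) (auto simp: pair_param_def Let_def)
qed (auto simp: pair_param_def Let_def)

lemma pair_cov_image_subset:
  assumes n: "n \<ge> 4"
  shows "pair_cov n ` carrier_vec n \<subseteq> pair_param n ` carrier_vec (n - 2)"
proof
  fix u assume "u \<in> pair_cov n ` carrier_vec n"
  then obtain v where v: "v \<in> carrier_vec n" "u = pair_cov n v" by blast
  show "u \<in> pair_param n ` carrier_vec (n - 2)"
  proof (cases "inj_on (($) v) {..<n}")
    case False
    \<comment> \<open>Coinciding points make the discriminant factor zero, so the value is zero,
      which is attained at the zero parameter.\<close>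
    then have "gap_prod {..<n} (\<lambda>i j. v $ i - v $ j) = 0"
      by (auto simp: gap_prod_eq_0_iff inj_on_def)
    then have "u = pair_param n (0\<^sub>v (n - 2))"
      using n v(2) by (auto simp: pair_cov_def pair_param_def)
    then show ?thesis by simp
  next
    case True
    have "n \<ge> 3" using n by simp
    obtain y l where y: "y 1 = 0" "y 2 = 1"
      and xl: "\<And>i j. i < n \<Longrightarrow> j < n \<Longrightarrow> v $ i - v $ j = l i * l j * bracket y i j"
      by (rule exists_normal_form[OF True \<open>n \<ge> 3\<close>]) (rule that)
    let ?A = "{..<n}"
    \<comment> \<open>The factors from \<open>gap_prod_scale\<close> and
      \<open>edge_prod_scale\<close>; their product is the same for every pair, so one coordinate
      can hold it.\<close>
    define s where "s = (\<Prod>i<n. l i) ^ (2 * (n - 1)) * (\<Prod>i<n. l i) ^ (2 * (n - 3))"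
    define w where "w = vec (n - 2) (\<lambda>i. if i = 0 then s else y (i + 2))"
    let ?y = "\<lambda>i. if i = 1 then 0 else if i = 2 then 1 else w $ (i - 2)"
    \<comment> \<open>Agreement of \<open>y\<close> with the values stored in \<open>w\<close> at
      nonzero indices is enough, as \<open>bracket\<close> does not read index 0.\<close>
    have br: "bracket y i j = bracket ?y i j" if "i < n" "j < n" for i j
    proof -
      have "y i = ?y i" if "i < n" "i \<noteq> 0" for i
      proof (cases "i = 1 \<or> i = 2")
        case True
        then show ?thesis using y by auto
      next
        case False
        then have "i - 2 < n - 2" "i - 2 \<noteq> 0" "i - 2 + 2 = i" using that by auto
        then show ?thesis using False by (simp add: w_def)
      qed
      from this[of i] this[of j] show ?thesis using that by (auto simp: bracket_def simp del: One_nat_def)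
    qed
    have "pair_cov n v $ e = pair_param n w $ e" if e: "e < n * n" for e
    proof -
      let ?a = "e div n" and ?b = "e mod n" and ?d = "bracket ?y"
      have ab: "?a < n" "?b < n" using div_mod_less[OF e] .
      have eq: "v $ i - v $ j = l i * l j * ?d i j" if "i < n" "j < n" for i j
        using xl[OF that] br[OF that] by simp
      have "gap_prod ?A (\<lambda>i j. v $ i - v $ j) = gap_prod ?A (\<lambda>i j. l i * l j * ?d i j)"
        by (intro gap_prod_cong eq) auto
      also have "\<dots> = (\<Prod>i<n. l i) ^ (2 * (n - 1)) * gap_prod ?A ?d"
        by (simp add: gap_prod_scale)
      finally have 1: "gap_prod ?A (\<lambda>i j. v $ i - v $ j) = \<dots>" .
      have "edge_prod ?A ?a ?b (\<lambda>i j. v $ i - v $ j) = edge_prod ?A ?a ?b (\<lambda>i j. l i * l j * ?d i j)"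
        using ab by (intro edge_prod_cong eq) auto
      also have "\<dots> = (\<Prod>i<n. l i) ^ (2 * (n - 3)) * edge_prod ?A ?a ?b ?d"
        using edge_prod_scale[of ?A ?a ?b ?d l] n ab by (simp add: bracket_def)
      finally have 2: "edge_prod ?A ?a ?b (\<lambda>i j. v $ i - v $ j) = \<dots>" .
      have "w $ 0 = s" using n by (simp add: w_def)
      then have "pair_param n w $ e = s * (gap_prod ?A ?d * edge_prod ?A ?a ?b ?d)"
        using e by (simp add: pair_param_def Let_def)
      also have "\<dots> = gap_prod ?A (\<lambda>i j. v $ i - v $ j) * edge_prod ?A ?a ?b (\<lambda>i j. v $ i - v $ j)"
        unfolding 1 2 s_def by (simp only: mult_ac)
      also have "\<dots> = pair_cov n v $ e" using e by (simp add: pair_cov_def)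
      finally show ?thesis ..
    qed
    moreover have "dim_vec (pair_cov n v) = n * n" "dim_vec (pair_param n w) = n * n"
      by (simp_all add: pair_cov_def pair_param_def Let_def)
    ultimately have "u = pair_param n w"
      unfolding v(2) by (intro eq_vecI) simp_all
    then show ?thesis by (auto simp: w_def)
  qed
qed

text \<open>If not, let \<open>x a\<close> tend to \<open>x k\<close> for some \<open>k\<close> outside \<open>{a, b, c, d}\<close>: only the right-hand
  side vanishes in the limit.\<close>

lemma edge_prod_eq_imp_mem:
  assumes n: "n \<ge> 5" and ab: "a < n" "b < n" "a \<noteq> b" and cd: "c < n" "d < n" "c \<noteq> d"
    and eq: "\<And>x :: nat \<Rightarrow> complex. inj_on x {..<n} \<Longrightarrow>
      edge_prod {..<n} a b (\<lambda>i j. x i - x j) = edge_prod {..<n} c d (\<lambda>i j. x i - x j)"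
  shows "a \<in> {c, d}"
proof (rule ccontr)
  assume a: "a \<notin> {c, d}"
  have "\<exists>k. k < n \<and> k \<notin> {a, b, c, d}"
  proof (rule ccontr)
    assume "\<not> (\<exists>k. k < n \<and> k \<notin> {a, b, c, d})"
    then have "{..<n} \<subseteq> {a, b, c, d}" by blast
    then have "n \<le> card {a, b, c, d}" using card_mono[of "{a, b, c, d}" "{..<n}"] by simp
    also have "\<dots> \<le> 4" by (auto simp: card_insert_if)
    finally show False using n by simp
  qed
  then obtain k where k: "k < n" "k \<notin> {a, b, c, d}" by blast
  \<comment> \<open>Every point sits at its own index, except that point \<open>a\<close> is
    displaced by \<open>t\<close> from point \<open>k\<close>.\<close>
  define x :: "complex \<Rightarrow> nat \<Rightarrow> complex" where
    "x t i = (if i = a then of_nat k + t else of_nat i)" for t i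
  define f where "f t = edge_prod {..<n} a b (\<lambda>i j. x t i - x t j)" for t
  define g where "g t = edge_prod {..<n} c d (\<lambda>i j. x t i - x t j)" for t
  \<comment> \<open>Natural numbers differ from \<open>k\<close> by integers, so the points stay
    distinct for \<open>t\<close> of norm strictly between 0 and 1.\<close>
  have nz: "of_nat k + t \<noteq> of_nat i" if "0 < norm t" "norm t < 1" for t :: complex and i
  proof
    assume "of_nat k + t = of_nat i"
    then have "t = of_int (int i - int k)" by (simp add: algebra_simps)
    then have "norm t = of_int \<bar>int i - int k\<bar>" by (metis norm_of_int of_int_abs)
    then have "0 < \<bar>int i - int k\<bar>" "\<bar>int i - int k\<bar> < 1" using that by simp_all
    then show False by linarith
  qed
  have "f t = g t" if "0 < norm t" "norm t < 1" for t
    unfolding f_def g_def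
  proof (rule eq)
    show "inj_on (x t) {..<n}"
    proof (rule inj_onI)
      fix i j assume "x t i = x t j"
      then show "i = j"
        using nz[OF that, of i] nz[OF that, of j] by (cases "i = a"; cases "j = a") (auto simp: x_def)
    qed
  qed
  then have ev: "eventually (\<lambda>t. f t = g t) (at 0)"
    unfolding eventually_at by (intro exI[of _ 1]) auto
  have xc: "isCont (\<lambda>t. x t i) 0" for i
    by (cases "i = a") (auto simp: x_def intro!: continuous_intros)
  have "isCont f 0" "isCont g 0"
    unfolding f_def g_def edge_prod_def gap_prod_def by (intro continuous_intros xc)+
  then have "(f \<longlongrightarrow> f 0) (at 0)" "(g \<longlongrightarrow> g 0) (at 0)" by (simp_all add: isCont_def)
  then have "f 0 = g 0"
    using ev tendsto_cong[OF ev] tendsto_unique[of "at 0" g] by auto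
  \<comment> \<open>Both \<open>a\<close> and \<open>k\<close> lie outside \<open>{c, d}\<close>, so
    \<open>g 0\<close> contains the factor \<open>x 0 a - x 0 k = 0\<close>.\<close>
  moreover have "g 0 = 0"
    using a k ab(1) by (auto simp: g_def edge_prod_def gap_prod_eq_0_iff x_def)
  \<comment> \<open>The colliding points are \<open>a\<close> and \<open>k\<close>, but in
    \<open>f\<close> the index \<open>a\<close> is paired only with \<open>b\<close>.\<close>
  moreover have "f 0 \<noteq> 0"
    using k ab by (auto simp: f_def edge_prod_def gap_prod_eq_0_iff x_def)
  ultimately show False by simp
qed

text \<open>Equivariance is a relabelling of the points. If \<open>g\<close> fixes the image
  pointwise, then at distinct points the discriminant cancels, and the edge products of a pair and
  of its translate under the inverse of \<open>g\<close> agree; \<open>edge_prod_eq_imp_mem\<close>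
  compares the pairs.\<close>

lemma faithful_pair_cov:
  assumes n: "n \<ge> 5"
  shows "\<exists>\<rho> \<sigma>. is_faithful_covariant (sym_group n) n \<rho> (n * n) \<sigma> (pair_cov n)"
proof -
  let ?G = "sym_group n"
  define \<pi> :: "(nat \<Rightarrow> nat) \<Rightarrow> nat \<Rightarrow> nat" where "\<pi> p i = p (Suc i) - 1" for p i
  define \<tau> where "\<tau> p e = \<pi> p (e div n) * n + \<pi> p (e mod n)" for p e
  interpret V: index_action ?G n \<pi> unfolding \<pi>_def by (rule index_action_sym_group)
  have "\<tau> = (\<lambda>p e. \<pi> p (e div n) * n + \<pi> p (e mod n))" by (simp add: \<tau>_def fun_eq_iff)
  then interpret W: index_action ?G "n * n" \<tau> using V.index_action_pairs by simp
  have cov: "pair_cov n (V.perm_rep g *\<^sub>v v) = W.perm_rep g *\<^sub>v pair_cov n v"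
    if g: "g \<in> carrier ?G" and v: "v \<in> carrier_vec n" for g v
  proof (rule eq_vecI)
    define q where "q = \<pi> (inv\<^bsub>?G\<^esub> g)"
    have q: "bij_betw q {..<n} {..<n}" unfolding q_def using g by (intro V.action_bij_betw V.inv_closed)
    have pv: "V.perm_rep g *\<^sub>v v = vec n (\<lambda>i. v $ q i)"
      unfolding q_def by (rule V.perm_rep_mult_vec[OF g v])
    have pw: "W.perm_rep g *\<^sub>v pair_cov n v = vec (n * n) (\<lambda>e. pair_cov n v $ \<tau> (inv\<^bsub>?G\<^esub> g) e)"
      by (rule W.perm_rep_mult_vec[OF g]) (simp add: pair_cov_def)
    show "dim_vec (pair_cov n (V.perm_rep g *\<^sub>v v)) = dim_vec (W.perm_rep g *\<^sub>v pair_cov n v)"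
      by (simp add: W.perm_rep_def pair_cov_def)
    fix e assume "e < dim_vec (W.perm_rep g *\<^sub>v pair_cov n v)"
    then have e: "e < n * n" by (simp add: W.perm_rep_def)
    let ?a = "e div n" and ?b = "e mod n" and ?d = "\<lambda>i j. v $ i - v $ j"
    have ab: "?a < n" "?b < n" using div_mod_less[OF e] .
    have t: "\<tau> (inv\<^bsub>?G\<^esub> g) e < n * n" using W.action_closed[OF V.inv_closed[OF g]] e by simp
    have qab: "q ?a < n" "q ?b < n" using q ab by (auto simp: bij_betw_def)
    have t': "\<tau> (inv\<^bsub>?G\<^esub> g) e div n = q ?a" "\<tau> (inv\<^bsub>?G\<^esub> g) e mod n = q ?b"
      using qab by (simp_all add: \<tau>_def q_def)
    have "gap_prod {..<n} ?d = gap_prod {..<n} (\<lambda>i j. ?d (q i) (q j))"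
      using gap_prod_image[of q "{..<n}" ?d] q by (simp add: bij_betw_def)
    moreover have "edge_prod {..<n} (q ?a) (q ?b) ?d = edge_prod {..<n} ?a ?b (\<lambda>i j. ?d (q i) (q j))"
      using edge_prod_image[OF q, of ?a ?b ?d] ab by simp
    moreover have "gap_prod {..<n} (\<lambda>i j. vec n (\<lambda>i. v $ q i) $ i - vec n (\<lambda>i. v $ q i) $ j) =
        gap_prod {..<n} (\<lambda>i j. ?d (q i) (q j))"
      by (intro gap_prod_cong) simp
    moreover have "edge_prod {..<n} ?a ?b (\<lambda>i j. vec n (\<lambda>i. v $ q i) $ i - vec n (\<lambda>i. v $ q i) $ j) =
        edge_prod {..<n} ?a ?b (\<lambda>i j. ?d (q i) (q j))"
      using ab by (intro edge_prod_cong) simp_all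
    ultimately show "pair_cov n (V.perm_rep g *\<^sub>v v) $ e = (W.perm_rep g *\<^sub>v pair_cov n v) $ e"
      unfolding pw pv using e t t' by (simp add: pair_cov_def)
  qed
  have "g = \<one>\<^bsub>?G\<^esub>" if g: "g \<in> carrier ?G"
    and inv: "\<And>w. w \<in> pair_cov n ` carrier_vec n \<Longrightarrow> W.perm_rep g *\<^sub>v w = w" for g
  proof -
    define q where "q = \<pi> (inv\<^bsub>?G\<^esub> g)"
    have q: "bij_betw q {..<n} {..<n}" unfolding q_def using g by (intro V.action_bij_betw V.inv_closed)
    then have ql: "q i < n" if "i < n" for i using that by (auto simp: bij_betw_def)
    have qi: "q i = q j \<longleftrightarrow> i = j" if "i < n" "j < n" for i j
      using q that by (auto simp: bij_betw_def inj_on_def)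
    have mem: "a \<in> {q a, q b}" if ab: "a < n" "b < n" "a \<noteq> b" for a b
    proof (rule edge_prod_eq_imp_mem[OF n ab])
      show "q a < n" "q b < n" "q a \<noteq> q b" using ql qi ab by auto
      fix x :: "nat \<Rightarrow> complex" assume x: "inj_on x {..<n}"
      define v where "v = vec n x"
      let ?d = "\<lambda>i j. v $ i - v $ j"
      have v: "v \<in> carrier_vec n" by (simp add: v_def)
      define e where "e = a * n + b"
      have e: "e < n * n" "e div n = a" "e mod n = b"
        using ab by (simp_all add: e_def pair_index_less)
      have "W.perm_rep g *\<^sub>v pair_cov n v = vec (n * n) (\<lambda>e. pair_cov n v $ \<tau> (inv\<^bsub>?G\<^esub> g) e)"
        by (rule W.perm_rep_mult_vec[OF g]) (simp add: pair_cov_def)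
      moreover have "W.perm_rep g *\<^sub>v pair_cov n v = pair_cov n v" using inv v by blast
      ultimately have "pair_cov n v $ e = pair_cov n v $ \<tau> (inv\<^bsub>?G\<^esub> g) e"
        using e(1) by (metis index_vec)
      moreover have "\<tau> (inv\<^bsub>?G\<^esub> g) e < n * n" using W.action_closed[OF V.inv_closed[OF g]] e by simp
      moreover have "\<tau> (inv\<^bsub>?G\<^esub> g) e div n = q a" "\<tau> (inv\<^bsub>?G\<^esub> g) e mod n = q b"
        using ql ab e by (simp_all add: \<tau>_def q_def)
      ultimately have "gap_prod {..<n} ?d * edge_prod {..<n} a b ?d =
          gap_prod {..<n} ?d * edge_prod {..<n} (q a) (q b) ?d"
        using e by (simp add: pair_cov_def)
      moreover have "gap_prod {..<n} ?d \<noteq> 0"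
        using x by (auto simp: gap_prod_eq_0_iff v_def inj_on_def)
      ultimately have "edge_prod {..<n} a b ?d = edge_prod {..<n} (q a) (q b) ?d" by simp
      moreover have "edge_prod {..<n} s t ?d = edge_prod {..<n} s t (\<lambda>i j. x i - x j)"
        if "s < n" "t < n" for s t
        using that by (intro edge_prod_cong) (auto simp: v_def)
      ultimately show "edge_prod {..<n} a b (\<lambda>i j. x i - x j) = edge_prod {..<n} (q a) (q b) (\<lambda>i j. x i - x j)"
        using ab ql by simp
    qed
    have "q a = a" if a: "a < n" for a
    proof (rule ccontr)
      assume "q a \<noteq> a"
      \<comment> \<open>By \<open>mem\<close> every other index would be sent to \<open>a\<close>;
        two such indices contradict injectivity.\<close>
      then have "q b = a" if "b < n" "b \<noteq> a" for b using mem[of a b] a that by auto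
      moreover obtain b c where "b < n" "c < n" "b \<noteq> a" "c \<noteq> a" "b \<noteq> c"
      proof -
        show thesis
          using n that[of "if a = 0 then 1 else 0" "if a = 2 then 1 else 2"]
          by (auto split: if_splits)
      qed
      ultimately show False using qi by metis
    qed
    then have \<pi>g: "\<pi> g i = i" if "i < n" for i
      using V.action_eq_iff[OF g that that] that unfolding q_def by metis
    have "g j = j" for j
    proof (cases "j \<in> {1..n}")
      case True
      have "g j \<in> {1..n}" using True g permutes_in_image by (fastforce simp: sym_group_carrier)
      moreover have "g j - 1 = j - 1" using \<pi>g[of "j - 1"] True by (simp add: \<pi>_def less_eq_Suc_le)
      ultimately show ?thesis using True unfolding atLeastAtMost_iff by linarith
    next
      case False
      then show ?thesis using g by (auto simp: sym_group_carrier intro: permutes_not_in)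
    qed
    then show ?thesis by (auto simp: sym_group_one)
  qed
  then have "is_faithful_covariant ?G n V.perm_rep (n * n) W.perm_rep (pair_cov n)"
    unfolding is_faithful_covariant_def is_covariant_def
    using V.is_module_perm_rep W.is_module_perm_rep poly_map_pair_cov cov by blast
  then show ?thesis by blast
qed

section \<open>Restriction to the alternating group, and the two bounds\<close>

lemma is_faithful_covariant_alt_group:
  assumes "is_faithful_covariant (sym_group n) m \<rho> k \<sigma> \<phi>"
  shows "is_faithful_covariant (alt_group n) m \<rho> k \<sigma> \<phi>"
proof -
  have sub: "carrier (alt_group n) \<subseteq> carrier (sym_group n)"
    by (auto simp: alt_group_carrier sym_group_carrier)
  then have "is_module (alt_group n) l \<eta>" if "is_module (sym_group n) l \<eta>" for l \<eta>
    using that by (auto simp: is_module_def hom_def alt_group_mult sym_group_mult)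
  then show ?thesis
    using assms sub unfolding is_faithful_covariant_def is_covariant_def
    by (auto simp: alt_group_one sym_group_one)
qed

theorem proposition8p1:
  fixes n :: nat
  assumes "n \<ge> 5"
  shows "covdim (alt_group n) \<le> covdim (sym_group n) \<and> covdim (sym_group n) \<le> enat (n - 2)"
proof
  show "covdim (alt_group n) \<le> covdim (sym_group n)"
    \<comment> \<open>Every faithful covariant of the symmetric group restricts to one of the
      alternating group with the same dimension, so the latter takes its infimum over a
      superset.\<close>
    unfolding covdim_def
    by (intro Inf_superset_mono) (blast intro: is_faithful_covariant_alt_group)
  obtain \<rho> \<sigma> where "is_faithful_covariant (sym_group n) n \<rho> (n * n) \<sigma> (pair_cov n)"
    using faithful_pair_cov[OF assms] by blast
  then have "covdim (sym_group n) \<le> covariant_dim n (n * n) (pair_cov n)"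
    unfolding covdim_def by (intro Inf_lower) blast
  also have "\<dots> \<le> enat (n - 2)"
    using assms by (intro covariant_dim_le[OF poly_map_pair_param pair_cov_image_subset]) auto
  finally show "covdim (sym_group n) \<le> enat (n - 2)" .
qed

end
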